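(* Let $C$ be a unital composition algebra over a field $F$ of characteristic zero. Then $\mathrm{rb}(C)=1$ if $C$ is a division algebra or $\dim C\le2$, and $\mathrm{rb}(C)=3$ if $C$ is split and $\dim C\in\{4,8\}$.
   Context: An algebra $A$ over $F$ ($\mathrm{char}\,F\ne2$) is a composition algebra if there is a nondegenerate quadratic form $n$ on $A$ with $n(xy)=n(x)n(y)$ for all $x,y$; a unital one has dimension 1, 2, 4 or 8, and it is split if $n(x)=0$ for some nonzero $x$, otherwise it is a division algebra. A linear operator $R$ on $A$ is a Rota–Baxter operator of weight $0$ if $R(x)R(y)=R(R(x)y+xR(y))$ for all $x,y$. The RB-index $\mathrm{rb}(A)$ is the least $n\in\mathbb N$ such that $R^n=0$ for every Rota–Baxter operator $R$ of weight zero on $A$. *)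

theory Defs
  imports Complex_Main
begin

text \<open>An algebra over a field F is modelled by a carrier type 'v with an
F-vector-space structure given by the scalar multiplication scale, and a
(not necessarily associative) bilinear multiplication mult.\<close>

definition bilinear_mult :: "('a::field \<Rightarrow> 'v::ab_group_add \<Rightarrow> 'v) \<Rightarrow> ('v \<Rightarrow> 'v \<Rightarrow> 'v) \<Rightarrow> bool" where
  "bilinear_mult scale mult \<longleftrightarrow>
     (\<forall>x. Vector_Spaces.linear scale scale (mult x)) \<and>
     (\<forall>y. Vector_Spaces.linear scale scale (\<lambda>x. mult x y))"

definition polar_form :: "('v::ab_group_add \<Rightarrow> 'a::field) \<Rightarrow> 'v \<Rightarrow> 'v \<Rightarrow> 'a" where
  "polar_form q x y = q (x + y) - q x - q y"

definition quadratic_form :: "('a::field \<Rightarrow> 'v::ab_group_add \<Rightarrow> 'v) \<Rightarrow> ('v \<Rightarrow> 'a) \<Rightarrow> bool" where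
  "quadratic_form scale q \<longleftrightarrow>
     (\<forall>a x. q (scale a x) = a ^ 2 * q x) \<and>
     (\<forall>x. Vector_Spaces.linear scale (*) (polar_form q x)) \<and>
     (\<forall>y. Vector_Spaces.linear scale (*) (\<lambda>x. polar_form q x y))"

definition nondegenerate_qf :: "('v::ab_group_add \<Rightarrow> 'a::field) \<Rightarrow> bool" where
  "nondegenerate_qf q \<longleftrightarrow> (\<forall>x. (\<forall>y. polar_form q x y = 0) \<longrightarrow> x = 0)"

definition composition_algebra ::
  "('a::field \<Rightarrow> 'v::ab_group_add \<Rightarrow> 'v) \<Rightarrow> ('v \<Rightarrow> 'v \<Rightarrow> 'v) \<Rightarrow> ('v \<Rightarrow> 'a) \<Rightarrow> bool" where
  "composition_algebra scale mult q \<longleftrightarrow>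
     vector_space scale \<and> bilinear_mult scale mult \<and>
     quadratic_form scale q \<and> nondegenerate_qf q \<and>
     (\<forall>x y. q (mult x y) = q x * q y)"

definition unital :: "('v::ab_group_add \<Rightarrow> 'v \<Rightarrow> 'v) \<Rightarrow> bool" where
  "unital mult \<longleftrightarrow> (\<exists>e. e \<noteq> 0 \<and> (\<forall>x. mult e x = x \<and> mult x e = x))"

definition split_ca :: "('v::ab_group_add \<Rightarrow> 'a::field) \<Rightarrow> bool" where
  "split_ca q \<longleftrightarrow> (\<exists>x. x \<noteq> 0 \<and> q x = 0)"

definition division_ca :: "('v::ab_group_add \<Rightarrow> 'a::field) \<Rightarrow> bool" where
  "division_ca q \<longleftrightarrow> \<not> split_ca q"

definition rota_baxter0 ::
  "('a::field \<Rightarrow> 'v::ab_group_add \<Rightarrow> 'v) \<Rightarrow> ('v \<Rightarrow> 'v \<Rightarrow> 'v) \<Rightarrow> ('v \<Rightarrow> 'v) \<Rightarrow> bool" where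
  "rota_baxter0 scale mult R \<longleftrightarrow>
     Vector_Spaces.linear scale scale R \<and>
     (\<forall>x y. mult (R x) (R y) = R (mult (R x) y + mult x (R y)))"

definition rb_index ::
  "('a::field \<Rightarrow> 'v::ab_group_add \<Rightarrow> 'v) \<Rightarrow> ('v \<Rightarrow> 'v \<Rightarrow> 'v) \<Rightarrow> nat" where
  "rb_index scale mult =
     (LEAST n. \<forall>R. rota_baxter0 scale mult R \<longrightarrow> (R ^^ n) = (\<lambda>_. 0))"

end

theory Submission
  imports Defs
begin

text \<open>
  The image of a Rota--Baxter operator \<open>R\<close> of weight zero does not contain the unit, since
  \<open>R x = 1\<close> would give \<open>1 = R (2 x) = 2\<close>, but it is closed under multiplication.  As
  \<open>y y = tr(y) y - q(y) 1\<close> for all \<open>y\<close>, the norm vanishes on the image; hence \<open>R = 0\<close> in the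
  division case.  The same quadratic identity turns the Rota--Baxter identity for the pair
  \<open>x, x\<close> into \<open>tr(x) R (R x) = \<langle>x, R x\<rangle> R 1\<close>, and \<open>R (R 1) = 0\<close>, so \<open>R\<close> cubed kills every
  \<open>x\<close> of nonzero trace, and therefore everything.

  If \<open>1\<close> and \<open>g\<close> span the algebra, then \<open>R 1\<close>, having zero norm and trace, is orthogonal to
  everything, so \<open>R 1 = 0\<close>.  Then \<open>R (R g) = 0\<close> forces \<open>R g\<close> to be a multiple of \<open>1\<close>, so that
  \<open>R = 0\<close>.  A split algebra of larger dimension contains a nontrivial idempotent \<open>e\<close> and some
  \<open>u \<noteq> 0\<close> with \<open>e u = u\<close> and \<open>u e = 0\<close>; there \<open>R x = \<langle>u, x\<rangle> e + \<langle>1 - e, x\<rangle> u\<close> is a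
  Rota--Baxter operator whose square is \<open>x \<mapsto> \<langle>u, x\<rangle> u\<close>.

  Since \<open>dim\<close> is \<open>0\<close> on infinite-dimensional spaces, the case \<open>dim \<le> 2\<close> also requires that
  unital composition algebras have finite dimension.
\<close>

lemma (in vector_space) span_pairE:
  assumes "x \<in> span {u, v}"
  obtains a b where "x = a *s u + b *s v"
proof -
  obtain a b where "x - a *s u = b *s v"
    using assms unfolding span_insert[of u] span_singleton by blast
  then have "x = a *s u + b *s v"
    by (simp add: diff_eq_eq add.commute)
  then show ?thesis by (rule that)
qed

section \<open>Nondegenerate quadratic spaces\<close>

locale nondegenerate_quadratic_space = vector_space scale
  for scale :: "'a::field \<Rightarrow> 'v::ab_group_add \<Rightarrow> 'v" (infixr \<open>*s\<close> 75) +
  fixes q :: "'v \<Rightarrow> 'a"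
  assumes quadratic_form: "quadratic_form scale q"
    and nondegenerate: "nondegenerate_qf q"
begin

abbreviation polar :: "'v \<Rightarrow> 'v \<Rightarrow> 'a" (\<open>\<langle>_,/ _\<rangle>\<close>)
  where "\<langle>x, y\<rangle> \<equiv> polar_form q x y"

sublocale polar_left: Vector_Spaces.linear scale "(*)" "\<lambda>x. \<langle>x, y\<rangle>" for y
  using quadratic_form by (simp add: quadratic_form_def)

sublocale polar_right: Vector_Spaces.linear scale "(*)" "polar x" for x
  using quadratic_form by (simp add: quadratic_form_def)

lemmas polar_bilinear =
  polar_left.add polar_left.diff polar_left.neg polar_left.scale
  polar_right.add polar_right.diff polar_right.neg polar_right.scale

lemma polar_commute: "\<langle>x, y\<rangle> = \<langle>y, x\<rangle>"
  by (simp add: polar_form_def add.commute)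

lemma norm_scale: "q (a *s x) = a\<^sup>2 * q x"
  using quadratic_form by (simp add: quadratic_form_def)

lemma norm_add: "q (x + y) = q x + q y + \<langle>x, y\<rangle>"
  by (simp add: polar_form_def)

lemma norm_zero [simp]: "q 0 = 0"
  using norm_scale[of 0 0] by simp

lemma polar_self: "\<langle>x, x\<rangle> = 2 * q x"
  using norm_scale[of 2 x] scale_left_distrib[of 1 1 x] by (simp add: polar_form_def)

lemma polar_eqI:
  assumes "\<And>z. \<langle>x, z\<rangle> = \<langle>y, z\<rangle>"
  shows "x = y"
proof -
  have "\<forall>z. \<langle>x - y, z\<rangle> = 0"
    using assms by (simp add: polar_left.diff)
  then have "x - y = 0"
    using nondegenerate unfolding nondegenerate_qf_def by blast
  then show ?thesis by simp
qed

lemma polar_nonzeroE: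
  assumes "x \<noteq> 0"
  obtains z where "\<langle>x, z\<rangle> \<noteq> 0"
  using polar_eqI[of x 0] assms by auto

definition orthogonal_complement :: "'v set \<Rightarrow> 'v set" where
  "orthogonal_complement S = {x. \<forall>s\<in>S. \<langle>x, s\<rangle> = 0}"

lemma mem_orthogonal_complement_insert [simp]:
  "x \<in> orthogonal_complement (insert s S) \<longleftrightarrow> \<langle>x, s\<rangle> = 0 \<and> x \<in> orthogonal_complement S"
  by (auto simp: orthogonal_complement_def)

lemma orthogonal_complement_empty [simp]: "orthogonal_complement {} = UNIV"
  by (simp add: orthogonal_complement_def)

lemma subspace_orthogonal_complement: "subspace (orthogonal_complement S)"
  by (simp add: subspace_def orthogonal_complement_def polar_bilinear)

lemma polar_orthogonal_complement_span:
  assumes "x \<in> orthogonal_complement S" "y \<in> span S"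
  shows "\<langle>x, y\<rangle> = 0"
  using assms(2)
proof (induction rule: span_induct)
  case base
  show ?case by (simp add: subspace_def polar_bilinear)
next
  case (step s)
  then show ?case using assms(1) by (simp add: orthogonal_complement_def)
qed

lemma hyperplane_codimension:
  assumes "subspace U"
  shows "\<exists>w\<in>U. \<forall>x\<in>U. \<exists>a. x - a *s w \<in> orthogonal_complement {s}"
proof (cases "\<exists>w\<in>U. \<langle>w, s\<rangle> \<noteq> 0")
  case True
  then obtain w where w: "w \<in> U" "\<langle>w, s\<rangle> \<noteq> 0"
    by blast
  have "x - (\<langle>x, s\<rangle> / \<langle>w, s\<rangle>) *s w \<in> orthogonal_complement {s}" for x
    using w by (simp add: polar_bilinear)
  with w show ?thesis by blast
next
  case False
  then show ?thesis
    using subspace_0[OF assms] by (intro bexI[of _ 0]) auto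
qed

lemma orthogonal_complement_finite_codimension:
  assumes "finite S" and "subspace U"
  shows "\<exists>T\<subseteq>U. finite T \<and> (\<forall>x\<in>U. \<exists>t\<in>span T. x - t \<in> orthogonal_complement S)"
  using assms
proof (induction S arbitrary: U)
  case empty
  then show ?case by (intro exI[of _ "{}"]) simp
next
  case (insert s S)
  let ?hyperplane = "orthogonal_complement {s}"
  obtain w where w: "w \<in> U" and mod_w: "\<And>x. x \<in> U \<Longrightarrow> \<exists>a. x - a *s w \<in> ?hyperplane"
    using hyperplane_codimension[OF \<open>subspace U\<close>] by blast
  have subspace_hyperplane: "subspace (U \<inter> ?hyperplane)"
    using insert.prems subspace_orthogonal_complement by (rule subspace_inter)
  obtain T where T: "T \<subseteq> U \<inter> ?hyperplane" "finite T"
    and mod_T: "\<And>x. x \<in> U \<inter> ?hyperplane \<Longrightarrow> \<exists>t\<in>span T. x - t \<in> orthogonal_complement S"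
    using insert.IH[OF subspace_hyperplane] by blast
  have "\<exists>t\<in>span (insert w T). x - t \<in> orthogonal_complement (insert s S)" if "x \<in> U" for x
  proof -
    obtain a where a: "x - a *s w \<in> U \<inter> ?hyperplane"
      using mod_w w \<open>x \<in> U\<close> insert.prems by (blast intro: subspace_diff subspace_scale)
    then obtain t where t: "t \<in> span T" "x - a *s w - t \<in> orthogonal_complement S"
      using mod_T by blast
    have "t \<in> U \<inter> ?hyperplane"
      using t(1) span_minimal[OF T(1) subspace_hyperplane] by blast
    with a have "x - a *s w - t \<in> ?hyperplane"
      using subspace_diff[OF subspace_hyperplane] by blast
    with t(2) have "x - (a *s w + t) \<in> orthogonal_complement (insert s S)"
      by (simp add: diff_diff_eq)
    moreover have "a *s w + t \<in> span (insert w T)"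
      using t(1) span_mono[of T "insert w T"] by (auto intro: span_add span_scale span_base)
    ultimately show ?thesis by blast
  qed
  moreover have "insert w T \<subseteq> U" "finite (insert w T)"
    using T w by auto
  ultimately show ?case by blast
qed

lemma zero_if_orthogonal_sum:
  assumes "w \<in> orthogonal_complement T" and "\<And>u. u \<in> U \<Longrightarrow> \<langle>w, u\<rangle> = 0"
    and sum: "\<And>z. \<exists>t\<in>span T. z - t \<in> U"
  shows "w = 0"
proof (rule polar_eqI)
  fix z
  obtain t where "t \<in> span T" "z - t \<in> U"
    using sum by blast
  then have "\<langle>w, t\<rangle> = 0" "\<langle>w, z - t\<rangle> = 0"
    using assms polar_orthogonal_complement_span by auto
  then show "\<langle>w, z\<rangle> = \<langle>0, z\<rangle>"
    by (simp add: polar_right.diff)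
qed

text \<open>A totally isotropic \<open>S\<^sup>\<bottom>\<close> pairs trivially with itself, so it embeds into the dual of a
  complement of \<open>S\<^sup>\<bottom>\<close>, which has finite dimension.\<close>

lemma finite_dimensional_if_totally_isotropic:
  assumes "finite S" and isotropic: "\<And>x y. x \<in> orthogonal_complement S \<Longrightarrow>
    y \<in> orthogonal_complement S \<Longrightarrow> \<langle>x, y\<rangle> = 0"
  shows "\<exists>T. finite T \<and> span T = UNIV"
proof -
  obtain T where T: "finite T" "\<And>x. \<exists>t\<in>span T. x - t \<in> orthogonal_complement S"
    using orthogonal_complement_finite_codimension[OF \<open>finite S\<close> subspace_UNIV]
    by (metis UNIV_I)
  obtain T' where T': "finite T'" "T' \<subseteq> orthogonal_complement S"
    "\<And>x. x \<in> orthogonal_complement S \<Longrightarrow> \<exists>t\<in>span T'. x - t \<in> orthogonal_complement T"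
    using orthogonal_complement_finite_codimension[OF \<open>finite T\<close> subspace_orthogonal_complement]
    by metis
  have "x \<in> span (T \<union> T')" for x
  proof -
    obtain t where t: "t \<in> span T" "x - t \<in> orthogonal_complement S"
      using T(2) by blast
    then obtain t' where t': "t' \<in> span T'" "x - t - t' \<in> orthogonal_complement T"
      using T'(3) by blast
    have "t' \<in> orthogonal_complement S"
      using t' span_minimal[OF T'(2) subspace_orthogonal_complement] by blast
    then have "x - t - t' \<in> orthogonal_complement S"
      using t(2) subspace_diff[OF subspace_orthogonal_complement] by blast
    then have "x - t - t' = 0"
      using t'(2) T(2) isotropic by (intro zero_if_orthogonal_sum)
    then have "x = t + t'"
      by (simp add: algebra_simps)
    then show ?thesis
      using t t' by (auto simp: span_Un)
  qed
  then show ?thesis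
    using T(1) T'(1) by (intro exI[of _ "T \<union> T'"]) auto
qed

lemma ex_anisotropic_orthogonal:
  assumes "finite S" and infinite_dimensional: "\<And>T. finite T \<Longrightarrow> span T \<noteq> UNIV"
  shows "\<exists>v\<in>orthogonal_complement S. q v \<noteq> 0"
proof (rule ccontr)
  assume "\<not> ?thesis"
  then have "\<langle>x, y\<rangle> = 0"
    if "x \<in> orthogonal_complement S" "y \<in> orthogonal_complement S" for x y
    using that norm_add[of x y] subspace_add[OF subspace_orthogonal_complement, of x S y] by simp
  then have "\<exists>T. finite T \<and> span T = UNIV"
    by (intro finite_dimensional_if_totally_isotropic[OF \<open>finite S\<close>])
  with infinite_dimensional show False by blast
qed

lemma hyperbolic_pair_orthogonalE:
  assumes "q e = 0" "q f = 0" "\<langle>e, f\<rangle> = 1" and "span {e, f} \<noteq> UNIV"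
  obtains v where "v \<noteq> 0" "\<langle>e, v\<rangle> = 0" "\<langle>f, v\<rangle> = 0"
proof -
  obtain x where x: "x \<notin> span {e, f}"
    using assms(4) by blast
  define p where "p = \<langle>f, x\<rangle> *s e + \<langle>e, x\<rangle> *s f"
  have "p \<in> span {e, f}"
    unfolding p_def by (intro span_add span_scale) (auto intro: span_base)
  then have "x - p \<noteq> 0"
    using x by auto
  moreover have "\<langle>e, x - p\<rangle> = 0" "\<langle>f, x - p\<rangle> = 0"
    using assms by (simp_all add: p_def polar_bilinear polar_self polar_commute[of f e])
  ultimately show ?thesis
    by (rule that)
qed

end

section \<open>Unital composition algebras\<close>

locale unital_composition_algebra = nondegenerate_quadratic_space scale q
  for scale :: "'a::field \<Rightarrow> 'v::ab_group_add \<Rightarrow> 'v" (infixr \<open>*s\<close> 75)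
    and q :: "'v \<Rightarrow> 'a" +
  fixes mult :: "'v \<Rightarrow> 'v \<Rightarrow> 'v" (infixl \<open>\<odot>\<close> 70)
    and one :: 'v (\<open>\<one>\<close>)
  assumes bilinear: "bilinear_mult scale mult"
    and norm_mult: "q (x \<odot> y) = q x * q y"
    and one_nonzero [simp]: "\<one> \<noteq> 0"
    and one_mult [simp]: "\<one> \<odot> x = x"
    and mult_one [simp]: "x \<odot> \<one> = x"
    and two_nonzero [simp]: "(2::'a) \<noteq> 0"
begin

sublocale mult_left: Vector_Spaces.linear scale scale "\<lambda>x. x \<odot> y" for y
  using bilinear by (simp add: bilinear_mult_def)

sublocale mult_right: Vector_Spaces.linear scale scale "mult x" for x
  using bilinear by (simp add: bilinear_mult_def)

lemmas mult_bilinear =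
  mult_left.add mult_left.diff mult_left.neg mult_left.scale
  mult_right.add mult_right.diff mult_right.neg mult_right.scale

lemma norm_one [simp]: "q \<one> = 1"
proof -
  obtain z where "\<langle>\<one>, z\<rangle> \<noteq> 0"
    using polar_nonzeroE one_nonzero by blast
  then have "\<exists>x. q x \<noteq> 0"
    by (metis polar_form_def diff_zero)
  then show ?thesis
    using norm_mult[of \<one>] by auto
qed

lemma polar_mult_right: "\<langle>x \<odot> z, y \<odot> z\<rangle> = \<langle>x, y\<rangle> * q z"
  using norm_mult[of "x + y" z] by (simp add: mult_left.add norm_add norm_mult algebra_simps)

lemma polar_mult_left: "\<langle>z \<odot> x, z \<odot> y\<rangle> = q z * \<langle>x, y\<rangle>"
  using norm_mult[of z "x + y"] by (simp add: mult_right.add norm_add norm_mult algebra_simps)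

lemma polar_mult_linearized: "\<langle>x \<odot> z, y \<odot> w\<rangle> + \<langle>x \<odot> w, y \<odot> z\<rangle> = \<langle>x, y\<rangle> * \<langle>z, w\<rangle>"
  using polar_mult_right[of x "z + w" y]
  by (simp add: mult_right.add polar_bilinear norm_add polar_mult_right polar_commute[of w z]
      algebra_simps)

abbreviation tr :: "'v \<Rightarrow> 'a"
  where "tr x \<equiv> \<langle>x, \<one>\<rangle>"

definition conjugate :: "'v \<Rightarrow> 'v" (\<open>_\<^sup>\<star>\<close> [1000] 1000)
  where "x\<^sup>\<star> = tr x *s \<one> - x"

lemma tr_one [simp]: "tr \<one> = 2"
  by (simp add: polar_self)

lemma conjugate_conjugate [simp]: "x\<^sup>\<star>\<^sup>\<star> = x"
  by (simp add: conjugate_def polar_bilinear)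

lemma polar_mult_conjugate_left:
  "\<langle>x \<odot> y, z\<rangle> = \<langle>y, x\<^sup>\<star> \<odot> z\<rangle>" "\<langle>z, x \<odot> y\<rangle> = \<langle>x\<^sup>\<star> \<odot> z, y\<rangle>"
proof -
  show "\<langle>x \<odot> y, z\<rangle> = \<langle>y, x\<^sup>\<star> \<odot> z\<rangle>" for x y z
    using polar_mult_linearized[of x y \<one> z]
    by (simp add: conjugate_def mult_bilinear polar_bilinear polar_commute[of "x \<odot> z"] algebra_simps)
  then show "\<langle>z, x \<odot> y\<rangle> = \<langle>x\<^sup>\<star> \<odot> z, y\<rangle>"
    by (metis polar_commute)
qed

lemma polar_mult_conjugate_right:
  "\<langle>y \<odot> x, z\<rangle> = \<langle>y, z \<odot> x\<^sup>\<star>\<rangle>" "\<langle>z, y \<odot> x\<rangle> = \<langle>z \<odot> x\<^sup>\<star>, y\<rangle>"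
proof -
  show "\<langle>y \<odot> x, z\<rangle> = \<langle>y, z \<odot> x\<^sup>\<star>\<rangle>" for x y z
    using polar_mult_linearized[of y x z \<one>]
    by (simp add: conjugate_def mult_bilinear polar_bilinear algebra_simps)
  then show "\<langle>z, y \<odot> x\<rangle> = \<langle>z \<odot> x\<^sup>\<star>, y\<rangle>"
    by (metis polar_commute)
qed

lemma conjugate_mult_mult: "x\<^sup>\<star> \<odot> (x \<odot> y) = q x *s y"
  by (rule polar_eqI)
    (simp add: polar_mult_conjugate_left(1)[of "x\<^sup>\<star>"] polar_mult_left polar_left.scale)

lemma mult_mult_conjugate: "(y \<odot> x) \<odot> x\<^sup>\<star> = q x *s y"
  by (rule polar_eqI)
    (simp add: polar_mult_conjugate_right(1)[of _ "x\<^sup>\<star>"] polar_mult_right polar_left.scale)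

lemma anisotropic_left_cancel:
  assumes "q x \<noteq> 0" "x \<odot> y = x \<odot> z"
  shows "y = z"
  using assms by (metis conjugate_mult_mult scale_left_imp_eq)

lemma anisotropic_right_cancel:
  assumes "q x \<noteq> 0" "y \<odot> x = z \<odot> x"
  shows "y = z"
  using assms by (metis mult_mult_conjugate scale_left_imp_eq)

lemma mult_left_quadratic: "x \<odot> (x \<odot> y) = tr x *s (x \<odot> y) - q x *s y"
  using conjugate_mult_mult[of x y] by (simp add: conjugate_def mult_bilinear algebra_simps)

lemma square_eq: "x \<odot> x = tr x *s x - q x *s \<one>"
  using mult_left_quadratic[of x \<one>] by simp

lemma mult_left_quadratic_linearized:
  "x \<odot> (y \<odot> z) + y \<odot> (x \<odot> z) = tr x *s (y \<odot> z) + tr y *s (x \<odot> z) - \<langle>x, y\<rangle> *s z"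
  using mult_left_quadratic[of "x + y" z] mult_left_quadratic[of x z] mult_left_quadratic[of y z]
  by (simp add: mult_bilinear polar_bilinear norm_add algebra_simps)

lemma mult_anticommutator: "x \<odot> y + y \<odot> x = tr x *s y + tr y *s x - \<langle>x, y\<rangle> *s \<one>"
  using mult_left_quadratic_linearized[of x y \<one>] by simp

lemma tr_mult: "tr (x \<odot> y) = tr x * tr y - \<langle>x, y\<rangle>"
  by (simp add: polar_mult_conjugate_left(1) conjugate_def polar_bilinear polar_commute[of y]
      mult.commute)

lemma conjugate_mult: "(x \<odot> y)\<^sup>\<star> = y\<^sup>\<star> \<odot> x\<^sup>\<star>"
proof -
  have "y\<^sup>\<star> \<odot> x\<^sup>\<star> = (tr x * tr y) *s \<one> - tr x *s y - tr y *s x + y \<odot> x"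
    by (simp add: conjugate_def mult_bilinear polar_bilinear algebra_simps)
  also have "y \<odot> x = tr x *s y + tr y *s x - \<langle>x, y\<rangle> *s \<one> - x \<odot> y"
    using mult_anticommutator[of x y] by (simp add: algebra_simps)
  finally show ?thesis
    by (simp add: conjugate_def tr_mult algebra_simps)
qed

subsection \<open>Finite dimension\<close>

lemma mult_commute_orthogonal:
  assumes "z \<in> orthogonal_complement {\<one>, y}"
  shows "y \<odot> z = z \<odot> y\<^sup>\<star>"
  using assms mult_anticommutator[of z y]
  by (simp add: conjugate_def mult_bilinear algebra_simps)

text \<open>The multiplication rules of the Cayley--Dickson double \<open>D + D z\<close>, for \<open>x\<close> and \<open>y\<close> in \<open>D\<close>.\<close>

lemma mult_mult_orthogonal:
  assumes "z \<in> orthogonal_complement {\<one>, x, y, y \<odot> x}"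
  shows "x \<odot> (y \<odot> z) = (y \<odot> x) \<odot> z"
proof -
  have "x \<odot> (y \<odot> z) = x \<odot> (z \<odot> y\<^sup>\<star>)"
    using assms by (simp add: mult_commute_orthogonal)
  also have "\<dots> = tr x *s (z \<odot> y\<^sup>\<star>) - z \<odot> (x \<odot> y\<^sup>\<star>)"
    using assms mult_left_quadratic_linearized[of x z "y\<^sup>\<star>"]
    by (simp add: polar_commute algebra_simps)
  also have "\<dots> = z \<odot> (x\<^sup>\<star> \<odot> y\<^sup>\<star>)"
    by (simp add: conjugate_def[of x] mult_bilinear)
  also have "\<dots> = (y \<odot> x) \<odot> z"
    using assms by (simp add: mult_commute_orthogonal[of z "y \<odot> x"] conjugate_mult)
  finally show ?thesis .
qed

lemma orthogonal_mult_mult: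
  assumes "z \<in> orthogonal_complement {\<one>, x, y, x \<odot> y}"
  shows "(z \<odot> y) \<odot> x = z \<odot> (x \<odot> y)"
proof -
  have z: "z\<^sup>\<star> = - z"
    using assms by (simp add: conjugate_def)
  have "\<langle>z, w\<^sup>\<star>\<rangle> = - \<langle>z, w\<rangle>" for w
    using assms by (simp add: conjugate_def polar_bilinear)
  then have "z \<in> orthogonal_complement {\<one>, x\<^sup>\<star>, y\<^sup>\<star>, y\<^sup>\<star> \<odot> x\<^sup>\<star>}"
    using assms by (simp flip: conjugate_mult)
  then have "x\<^sup>\<star> \<odot> (y\<^sup>\<star> \<odot> z) = (y\<^sup>\<star> \<odot> x\<^sup>\<star>) \<odot> z"
    by (rule mult_mult_orthogonal)
  then have "(x\<^sup>\<star> \<odot> (y\<^sup>\<star> \<odot> z))\<^sup>\<star> = ((y\<^sup>\<star> \<odot> x\<^sup>\<star>) \<odot> z)\<^sup>\<star>"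
    by simp
  then show ?thesis
    by (simp add: conjugate_mult z mult_bilinear)
qed

text \<open>The octonions generated by \<open>a, b, c\<close> cannot be doubled by \<open>z\<close>: both ways of pulling \<open>z\<close>
  out of \<open>a (b (c z))\<close> would make \<open>a\<close> and \<open>b\<close> commute.\<close>

lemma no_fourth_doubling:
  assumes a: "a \<in> orthogonal_complement {\<one>}"
    and b: "b \<in> orthogonal_complement {\<one>, a}"
    and c: "c \<in> orthogonal_complement {\<one>, a, b, a \<odot> b}"
    and z: "z \<in> orthogonal_complement
      {\<one>, a, b, b \<odot> a, c, c \<odot> a, c \<odot> b, c \<odot> b \<odot> a, c \<odot> (b \<odot> a)}"
    and nonzero: "q b \<noteq> 0" "q c \<noteq> 0" "q z \<noteq> 0"
  shows "a = 0"
proof -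
  have "\<langle>c \<odot> z, x\<rangle> = - \<langle>z, c \<odot> x\<rangle>" for x
    using c by (simp add: polar_mult_conjugate_left(1) conjugate_def polar_right.neg mult_left.neg)
  then have cz: "c \<odot> z \<in> orthogonal_complement {\<one>, a, b, b \<odot> a}"
    using z by simp
  have "(c \<odot> b \<odot> a) \<odot> z = a \<odot> ((c \<odot> b) \<odot> z)"
    using z by (simp add: mult_mult_orthogonal)
  also have "\<dots> = a \<odot> (b \<odot> (c \<odot> z))"
    using z by (simp add: mult_mult_orthogonal)
  also have "\<dots> = (b \<odot> a) \<odot> (c \<odot> z)"
    using cz by (rule mult_mult_orthogonal)
  also have "\<dots> = (c \<odot> (b \<odot> a)) \<odot> z"
    using z by (simp add: mult_mult_orthogonal)
  finally have "c \<odot> b \<odot> a = c \<odot> (b \<odot> a)"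
    using nonzero anisotropic_right_cancel by blast
  moreover have "c \<odot> b \<odot> a = c \<odot> (a \<odot> b)"
    using c by (rule orthogonal_mult_mult)
  ultimately have "a \<odot> b = b \<odot> a"
    using nonzero anisotropic_left_cancel by metis
  also have "\<dots> = - (a \<odot> b)"
    using a b mult_commute_orthogonal[of b a] by (simp add: conjugate_def mult_right.neg)
  finally have "2 *s (a \<odot> b) = 0"
    using scale_left_distrib[of 1 1 "a \<odot> b"] by (simp add: eq_neg_iff_add_eq_0)
  then have "a \<odot> b = 0 \<odot> b"
    by simp
  with nonzero show ?thesis
    by (blast dest: anisotropic_right_cancel)
qed

lemma finite_dimensional: "\<exists>S. finite S \<and> span S = UNIV"
proof (rule ccontr)
  assume "\<not> ?thesis"
  then have anisotropic: "\<exists>v\<in>orthogonal_complement S. q v \<noteq> 0" if "finite S" for S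
    using that ex_anisotropic_orthogonal by blast
  obtain a where a: "q a \<noteq> 0" "a \<in> orthogonal_complement {\<one>}"
    using anisotropic by blast
  obtain b where b: "q b \<noteq> 0" "b \<in> orthogonal_complement {\<one>, a}"
    using anisotropic by (meson finite.emptyI finite.insertI)
  obtain c where c: "q c \<noteq> 0" "c \<in> orthogonal_complement {\<one>, a, b, a \<odot> b}"
    using anisotropic by (meson finite.emptyI finite.insertI)
  obtain z where z: "q z \<noteq> 0" "z \<in> orthogonal_complement
      {\<one>, a, b, b \<odot> a, c, c \<odot> a, c \<odot> b, c \<odot> b \<odot> a, c \<odot> (b \<odot> a)}"
    using anisotropic by (meson finite.emptyI finite.insertI)
  have "a = 0"
    using a b c z by (intro no_fourth_doubling)
  with a show False by simp
qed

lemma dim_le_2_spanE: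
  assumes "dim (UNIV :: 'v set) \<le> 2"
  obtains g where "span {\<one>, g} = UNIV"
proof -
  obtain S where S: "{\<one>} \<subseteq> S" "independent S" "UNIV \<subseteq> span S"
    using maximal_independent_subset_extend[of "{\<one>}" UNIV] by auto
  obtain T where "finite T" "span T = UNIV"
    using finite_dimensional by blast
  then have "finite S"
    using independent_span_bound[of T S] S by simp
  have "card S \<le> 2"
    using assms dim_eq_card[of S UNIV] S by (simp add: top.extremum_unique)
  then have "card (S - {\<one>}) \<le> Suc 0"
    using S \<open>finite S\<close> by simp
  then have "\<forall>x\<in>S - {\<one>}. \<forall>y\<in>S - {\<one>}. x = y"
    using \<open>finite S\<close> by (simp add: card_le_Suc0_iff_eq)
  then obtain g where "S - {\<one>} \<subseteq> {g}"
    by blast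
  then have "S \<subseteq> {\<one>, g}"
    by blast
  then have "span {\<one>, g} = UNIV"
    using span_mono[of S "{\<one>, g}"] S by auto
  then show ?thesis by (rule that)
qed

end

section \<open>Rota--Baxter operators of weight zero\<close>

lemma rb_index_eq_SucI:
  assumes nilpotent: "\<And>R. rota_baxter0 scale mult R \<Longrightarrow> R ^^ Suc n = (\<lambda>_. 0)"
    and R: "rota_baxter0 scale mult R" "(R ^^ n) x \<noteq> 0"
  shows "rb_index scale mult = Suc n"
  unfolding rb_index_def
proof (rule Least_equality)
  show "\<forall>R. rota_baxter0 scale mult R \<longrightarrow> R ^^ Suc n = (\<lambda>_. 0)"
    using nilpotent by blast
next
  fix m
  assume "\<forall>R. rota_baxter0 scale mult R \<longrightarrow> R ^^ m = (\<lambda>_. 0)"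
  with R(1) have m: "R ^^ m = (\<lambda>_. 0)"
    by blast
  interpret Vector_Spaces.linear scale scale R
    using R(1) by (simp add: rota_baxter0_def)
  have funpow_zero: "(R ^^ k) 0 = 0" for k
    by (induction k) simp_all
  show "Suc n \<le> m"
  proof (rule ccontr)
    assume "\<not> Suc n \<le> m"
    then have "(R ^^ n) x = (R ^^ (n - m)) ((R ^^ m) x)"
      by (simp flip: funpow_add comp_apply[of "R ^^ (n - m)"])
    with R(2) show False
      by (simp add: m funpow_zero)
  qed
qed

locale rota_baxter_operator = unital_composition_algebra scale q mult one
  for scale :: "'a::field \<Rightarrow> 'v::ab_group_add \<Rightarrow> 'v" (infixr \<open>*s\<close> 75)
    and q :: "'v \<Rightarrow> 'a"
    and mult :: "'v \<Rightarrow> 'v \<Rightarrow> 'v" (infixl \<open>\<odot>\<close> 70)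
    and one :: 'v (\<open>\<one>\<close>) +
  fixes R :: "'v \<Rightarrow> 'v"
  assumes rota_baxter: "rota_baxter0 scale mult R"
begin

sublocale R: Vector_Spaces.linear scale scale R
  using rota_baxter by (simp add: rota_baxter0_def)

lemma mult_image: "R x \<odot> R y = R (R x \<odot> y + x \<odot> R y)"
  using rota_baxter unfolding rota_baxter0_def by blast

lemma image_ne_one: "R x \<noteq> \<one>"
proof
  assume "R x = \<one>"
  with mult_image[of x x] have "\<one> = \<one> + \<one>"
    by (simp add: R.add)
  then show False by simp
qed

lemma norm_image: "q (R x) = 0"
proof (rule ccontr)
  assume nonzero: "q (R x) \<noteq> 0"
  define y where "y = tr (R x) *s x - (R x \<odot> x + x \<odot> R x)"
  have "R y = tr (R x) *s R x - R x \<odot> R x"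
    by (simp add: y_def R.diff R.scale mult_image)
  also have "\<dots> = q (R x) *s \<one>"
    by (simp add: square_eq)
  finally have "R ((1 / q (R x)) *s y) = \<one>"
    using nonzero by (simp add: R.scale)
  then show False
    using image_ne_one by blast
qed

lemma square_image: "R x \<odot> R x = tr (R x) *s R x"
  using square_eq[of "R x"] by (simp add: norm_image)

lemma tr_eigenvector:
  assumes eigenvector: "R x = a *s x" and "a \<noteq> 0"
  shows "tr x = 0"
proof -
  have "q x = 0"
    using norm_image[of x] assms by (simp add: norm_scale)
  then have square: "x \<odot> x = tr x *s x"
    by (simp add: square_eq)
  define y where "y = (a * tr x * a) *s x"
  have "y = R x \<odot> R x"
    by (simp add: y_def eigenvector square mult_bilinear mult.commute)
  also have "\<dots> = R (R x \<odot> x + x \<odot> R x)"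
    by (rule mult_image)
  also have "\<dots> = y + y"
    by (simp add: y_def eigenvector square mult_bilinear R.add R.scale)
  finally have "y = 0"
    by simp
  with \<open>a \<noteq> 0\<close> show ?thesis
    by (auto simp: y_def)
qed

lemma image_image_one_eigenvector: "R (R \<one>) = (tr (R \<one>) / 2) *s R \<one>"
proof -
  have "2 *s R (R \<one>) = R \<one> \<odot> R \<one>"
    using scale_left_distrib[of 1 1 "R (R \<one>)"] by (simp add: mult_image R.add)
  also have "\<dots> = 2 *s ((tr (R \<one>) / 2) *s R \<one>)"
    by (simp add: square_image)
  finally show ?thesis
    by (metis scale_left_imp_eq two_nonzero)
qed

lemma tr_image_one: "tr (R \<one>) = 0"
  using tr_eigenvector[OF image_image_one_eigenvector] by fastforce

lemma image_image_one: "R (R \<one>) = 0"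
  using image_image_one_eigenvector by (simp add: tr_image_one)

lemma tr_scale_image_image: "tr x *s R (R x) = \<langle>x, R x\<rangle> *s R \<one>"
proof -
  have "tr (R x) *s R x = R (R x \<odot> x + x \<odot> R x)"
    using mult_image[of x x] square_image[of x] by simp
  also have "\<dots> = tr (R x) *s R x + tr x *s R (R x) - \<langle>x, R x\<rangle> *s R \<one>"
    by (simp add: mult_anticommutator R.add R.diff R.scale polar_commute[of "R x" x])
  finally show ?thesis
    by (simp add: algebra_simps)
qed

lemma cube_zero: "R (R (R x)) = 0"
proof -
  have cube_zero_if_tr_nonzero: "R (R (R y)) = 0" if "tr y \<noteq> 0" for y
  proof -
    have "tr y *s R (R (R y)) = R (tr y *s R (R y))"
      by (simp add: R.scale)
    also have "\<dots> = 0"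
      by (simp add: tr_scale_image_image R.scale image_image_one)
    finally show ?thesis
      using that by simp
  qed
  show ?thesis
  proof (cases "tr x = 0")
    case True
    then have "R (R (R (x + \<one>))) = 0"
      by (intro cube_zero_if_tr_nonzero) (simp add: polar_left.add)
    then show ?thesis
      by (simp add: R.add image_image_one)
  qed (rule cube_zero_if_tr_nonzero)
qed

lemma image_one_zero_if_span_pair:
  assumes span: "span {\<one>, g} = UNIV"
  shows "R \<one> = 0"
proof -
  define c where "c = R \<one>"
  have c: "q c = 0" "tr c = 0"
    by (simp_all add: c_def norm_image tr_image_one)
  obtain a b where ab: "c = a *s \<one> + b *s g"
    using span_pairE span by blast
  show ?thesis
  proof (cases "b = 0")
    case True
    with c ab have "c = 0"
      by (simp add: norm_scale)
    then show ?thesis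
      by (simp add: c_def)
  next
    case False
    have "b * \<langle>c, g\<rangle> = \<langle>c, c - a *s \<one>\<rangle>"
      by (subst (2) ab) (simp add: polar_right.scale)
    also have "\<dots> = 0"
      by (simp add: polar_bilinear polar_self c)
    finally have "c \<in> orthogonal_complement {\<one>, g}"
      using False c by simp
    then have "\<langle>c, z\<rangle> = 0" for z
      using polar_orthogonal_complement_span span by blast
    then have "c = 0"
      by (intro polar_eqI) simp
    then show ?thesis
      by (simp add: c_def)
  qed
qed

lemma zero_if_span_pair:
  assumes span: "span {\<one>, g} = UNIV"
  shows "R x = 0"
proof -
  have coordinates: "\<exists>a b. y = a *s \<one> + b *s g" for y
    using span_pairE span by blast
  have R: "R (a *s \<one> + b *s g) = b *s R g" for a b
    by (simp add: R.add R.scale image_one_zero_if_span_pair[OF span])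
  obtain a b where Rg: "R g = a *s \<one> + b *s g"
    using coordinates by blast
  have "R \<one> \<odot> R g = R (R \<one> \<odot> g + R g)"
    using mult_image[of \<one> g] by simp
  then have "R (R g) = 0"
    by (simp add: image_one_zero_if_span_pair[OF span])
  then have "b = 0 \<or> R g = 0"
    by (subst (asm) Rg) (simp add: R)
  then have "R g = 0"
    using norm_image[of g] Rg by (auto simp: norm_scale)
  then show ?thesis
    using coordinates[of x] by (auto simp: R)
qed

end

context unital_composition_algebra
begin

lemma rota_baxter_operatorI:
  "rota_baxter0 scale mult R \<Longrightarrow> rota_baxter_operator scale q mult \<one> R"
  by unfold_locales

lemma rota_baxter_zero: "rota_baxter0 scale mult (\<lambda>_. 0)"
  using vector_space_axioms by (simp add: rota_baxter0_def Vector_Spaces.linear_iff)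

lemma rb_index_eq_1I:
  assumes "\<And>R x. rota_baxter0 scale mult R \<Longrightarrow> R x = 0"
  shows "rb_index scale mult = 1"
  using rb_index_eq_SucI[of scale mult 0 "\<lambda>_. 0" \<one>] assms rota_baxter_zero by fastforce

lemma rb_index_eq_3I:
  assumes R: "rota_baxter0 scale mult R" and "R (R x) \<noteq> 0"
  shows "rb_index scale mult = 3"
proof -
  have cube: "R' ^^ Suc 2 = (\<lambda>_. 0)" if "rota_baxter0 scale mult R'" for R'
    using rota_baxter_operator.cube_zero[OF rota_baxter_operatorI[OF that]]
    by (simp add: fun_eq_iff numeral_2_eq_2)
  have "(R ^^ 2) x \<noteq> 0"
    using assms(2) by (simp add: numeral_2_eq_2)
  then show ?thesis
    using rb_index_eq_SucI[OF cube R] by simp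
qed

lemma rb_index_division:
  assumes "division_ca q"
  shows "rb_index scale mult = 1"
proof (rule rb_index_eq_1I)
  fix R x
  assume "rota_baxter0 scale mult R"
  then interpret rota_baxter_operator scale q mult \<one> R
    by (rule rota_baxter_operatorI)
  show "R x = 0"
    using assms norm_image[of x] by (auto simp: division_ca_def split_ca_def)
qed

lemma rb_index_dim_le_2:
  assumes "dim (UNIV :: 'v set) \<le> 2"
  shows "rb_index scale mult = 1"
proof (rule rb_index_eq_1I)
  fix R x
  assume "rota_baxter0 scale mult R"
  then interpret rota_baxter_operator scale q mult \<one> R
    by (rule rota_baxter_operatorI)
  obtain g where "span {\<one>, g} = UNIV"
    using dim_le_2_spanE[OF assms] .
  then show "R x = 0"
    by (rule zero_if_span_pair)
qed

section \<open>Split algebras\<close>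

definition nontrivial_idempotent :: "'v \<Rightarrow> bool" where
  "nontrivial_idempotent e \<longleftrightarrow> e \<odot> e = e \<and> e \<noteq> 0 \<and> e \<noteq> \<one>"

lemma nontrivial_idempotent_iff: "nontrivial_idempotent e \<longleftrightarrow> q e = 0 \<and> tr e = 1"
proof
  assume e: "nontrivial_idempotent e"
  have "q e * q e = q e"
    using e norm_mult[of e e] by (simp add: nontrivial_idempotent_def)
  moreover have "q e \<noteq> 1"
    using e anisotropic_left_cancel[of e e \<one>] by (auto simp: nontrivial_idempotent_def)
  ultimately have "q e = 0"
    by simp
  moreover from this have "(tr e - 1) *s e = 0"
    using e square_eq[of e] by (simp add: nontrivial_idempotent_def scale_left_diff_distrib)
  ultimately show "q e = 0 \<and> tr e = 1"
    using e by (simp add: nontrivial_idempotent_def)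
next
  assume "q e = 0 \<and> tr e = 1"
  then show "nontrivial_idempotent e"
    using square_eq[of e] by (auto simp: nontrivial_idempotent_def)
qed

lemma conjugate_idempotent: "nontrivial_idempotent e \<Longrightarrow> e\<^sup>\<star> = \<one> - e"
  by (simp add: nontrivial_idempotent_iff conjugate_def)

lemma nontrivial_idempotent_conjugate:
  assumes "nontrivial_idempotent e"
  shows "nontrivial_idempotent (e\<^sup>\<star>)"
  using assms
  by (auto simp: nontrivial_idempotent_def conjugate_idempotent[OF assms] mult_bilinear)

lemma polar_idempotent_conjugate:
  assumes "nontrivial_idempotent e"
  shows "\<langle>e, e\<^sup>\<star>\<rangle> = 1"
  using assms by (simp add: nontrivial_idempotent_iff conjugate_def polar_bilinear polar_self)

lemma split_nontrivial_idempotentE: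
  assumes "split_ca q"
  obtains e where "nontrivial_idempotent e"
proof -
  obtain x where x: "x \<noteq> 0" "q x = 0"
    using assms by (auto simp: split_ca_def)
  obtain w where w: "\<langle>x, w\<rangle> \<noteq> 0"
    using x polar_nonzeroE by blast
  have "tr (x \<odot> w\<^sup>\<star>) = \<langle>x, w\<rangle>"
    by (simp add: polar_mult_conjugate_right(1))
  moreover have "q (x \<odot> w\<^sup>\<star>) = 0"
    by (simp add: norm_mult x)
  ultimately have "nontrivial_idempotent ((1 / \<langle>x, w\<rangle>) *s (x \<odot> w\<^sup>\<star>))"
    using w by (simp add: nontrivial_idempotent_iff norm_scale polar_left.scale)
  then show ?thesis by (rule that)
qed

lemma peirce_vectorE:
  assumes e: "nontrivial_idempotent e" and span: "span {e, e\<^sup>\<star>} \<noteq> UNIV"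
  obtains e' u where "nontrivial_idempotent e'" "u \<noteq> 0" "e' \<odot> u = u" "u \<odot> e' = 0"
proof -
  note e' = nontrivial_idempotent_conjugate[OF e]
  obtain v where v: "v \<noteq> 0" "\<langle>e, v\<rangle> = 0" "\<langle>e\<^sup>\<star>, v\<rangle> = 0"
    using hyperbolic_pair_orthogonalE[OF _ _ polar_idempotent_conjugate[OF e] span] e e'
    by (auto simp: nontrivial_idempotent_iff)
  have "tr v = 0"
    using v conjugate_idempotent[OF e] by (simp add: polar_bilinear polar_commute[of v])
  then have peirce_sum: "e \<odot> v + v \<odot> e = v"
    using mult_anticommutator[of e v] e v by (simp add: nontrivial_idempotent_iff)
  have e_ev: "e \<odot> (e \<odot> v) = e \<odot> v"
    using mult_left_quadratic[of e v] e by (simp add: nontrivial_idempotent_iff)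
  show ?thesis
  proof (cases "e \<odot> v = 0")
    case False
    have "tr (e \<odot> v) = 0" "\<langle>e, e \<odot> v\<rangle> = 0"
      using e v \<open>tr v = 0\<close> polar_mult_left[of e \<one> v]
      by (simp_all add: tr_mult nontrivial_idempotent_iff)
    then have "(e \<odot> v) \<odot> e = 0"
      using mult_anticommutator[of e "e \<odot> v"] e e_ev by (simp add: nontrivial_idempotent_iff)
    then show ?thesis
      using that[OF e False e_ev] by blast
  next
    case True
    then have "e\<^sup>\<star> \<odot> v = v" "v \<odot> e\<^sup>\<star> = 0"
      using peirce_sum by (simp_all add: conjugate_idempotent[OF e] mult_bilinear)
    then show ?thesis
      using that[OF e' v(1)] by blast
  qed
qed

text \<open>On the 2-by-2 matrices with \<open>e = e\<^sub>1\<^sub>1\<close> and \<open>u = e\<^sub>1\<^sub>2\<close> this is the operator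
  \<open>e\<^sub>2\<^sub>1 \<mapsto> -e\<^sub>1\<^sub>1\<close>, \<open>e\<^sub>1\<^sub>1 \<mapsto> e\<^sub>1\<^sub>2\<close>; it vanishes on their orthogonal complement.\<close>

definition peirce_operator :: "'v \<Rightarrow> 'v \<Rightarrow> 'v \<Rightarrow> 'v" where
  "peirce_operator e u x = \<langle>u, x\<rangle> *s e + \<langle>e\<^sup>\<star>, x\<rangle> *s u"

context
  fixes e u
  assumes e: "nontrivial_idempotent e" and e_u: "e \<odot> u = u" and u_e: "u \<odot> e = 0"
begin

lemma peirce_vector_isotropic: "q u = 0" "tr u = 0" "\<langle>u, e\<rangle> = 0"
proof -
  show "q u = 0"
    using e e_u norm_mult[of e u] by (simp add: nontrivial_idempotent_iff)
  show "\<langle>u, e\<rangle> = 0"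
    using e e_u tr_mult[of e u] by (simp add: nontrivial_idempotent_iff polar_commute)
  with e u_e tr_mult[of u e] show "tr u = 0"
    by (simp add: nontrivial_idempotent_iff)
qed

lemma peirce_vector_conjugate: "u\<^sup>\<star> = - u"
  by (simp add: conjugate_def peirce_vector_isotropic)

lemma peirce_vector_mult: "u \<odot> u = 0" "e\<^sup>\<star> \<odot> u = 0" "u \<odot> e\<^sup>\<star> = u"
  by (simp_all add: square_eq peirce_vector_isotropic conjugate_idempotent[OF e]
      mult_bilinear e_u u_e)

lemma rota_baxter_peirce_operator: "rota_baxter0 scale mult (peirce_operator e u)"
proof -
  have idempotent: "e \<odot> e = e" "e\<^sup>\<star> \<odot> e\<^sup>\<star> = e\<^sup>\<star>"
    using e nontrivial_idempotent_conjugate[OF e] by (simp_all add: nontrivial_idempotent_def)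
  note adjoints =
    polar_mult_conjugate_left(2)[where x = e] polar_mult_conjugate_left(2)[where x = u]
    polar_mult_conjugate_right(2)[where x = e] polar_mult_conjugate_right(2)[where x = u]
  have "Vector_Spaces.linear scale scale (peirce_operator e u)"
    using vector_space_axioms
    by (simp add: Vector_Spaces.linear_iff peirce_operator_def polar_bilinear algebra_simps)
  moreover have "peirce_operator e u x \<odot> peirce_operator e u y =
      peirce_operator e u (peirce_operator e u x \<odot> y + x \<odot> peirce_operator e u y)" for x y
  proof -
    define z where "z = peirce_operator e u x \<odot> y + x \<odot> peirce_operator e u y"
    have "\<langle>u, z\<rangle> = \<langle>u, x\<rangle> * \<langle>u, y\<rangle>" "\<langle>e\<^sup>\<star>, z\<rangle> = \<langle>u, x\<rangle> * \<langle>e\<^sup>\<star>, y\<rangle>"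
      by (simp_all add: z_def peirce_operator_def mult_bilinear polar_bilinear adjoints
          peirce_vector_conjugate peirce_vector_mult idempotent)
    then have "peirce_operator e u z =
        (\<langle>u, x\<rangle> * \<langle>u, y\<rangle>) *s e + (\<langle>u, x\<rangle> * \<langle>e\<^sup>\<star>, y\<rangle>) *s u"
      by (simp add: peirce_operator_def)
    also have "\<dots> = peirce_operator e u x \<odot> peirce_operator e u y"
      by (simp add: peirce_operator_def mult_bilinear e_u u_e idempotent peirce_vector_mult
          scale_right_distrib mult.commute)
    finally show ?thesis
      by (simp add: z_def)
  qed
  ultimately show ?thesis
    by (simp add: rota_baxter0_def)
qed

lemma peirce_operator_square: "peirce_operator e u (peirce_operator e u x) = \<langle>u, x\<rangle> *s u"
proof -
  have "\<langle>e\<^sup>\<star>, e\<rangle> = 1" "\<langle>e\<^sup>\<star>, u\<rangle> = 0" "\<langle>u, u\<rangle> = 0"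
    using polar_idempotent_conjugate[OF e] peirce_vector_isotropic
    by (simp_all add: polar_commute[of "e\<^sup>\<star>"] polar_self)
      (simp add: conjugate_def polar_bilinear)
  then show ?thesis
    by (simp add: peirce_operator_def[of e u "peirce_operator e u x"])
      (simp add: peirce_operator_def polar_bilinear peirce_vector_isotropic)
qed

end

lemma rb_index_split:
  assumes "split_ca q" and "2 < dim (UNIV :: 'v set)"
  shows "rb_index scale mult = 3"
proof -
  obtain e where e: "nontrivial_idempotent e"
    using split_nontrivial_idempotentE assms(1) .
  have "card {e, e\<^sup>\<star>} \<le> 2"
    by (simp add: card_insert_if)
  then have "span {e, e\<^sup>\<star>} \<noteq> UNIV"
    using assms(2) dim_le_card[of UNIV "{e, e\<^sup>\<star>}"] by auto
  with e obtain e' u where u: "nontrivial_idempotent e'" "u \<noteq> 0" "e' \<odot> u = u" "u \<odot> e' = 0"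
    by (rule peirce_vectorE)
  obtain x where "\<langle>u, x\<rangle> \<noteq> 0"
    using polar_nonzeroE u(2) by blast
  then have "peirce_operator e' u (peirce_operator e' u x) \<noteq> 0"
    using u by (simp add: peirce_operator_square)
  then show ?thesis
    by (rule rb_index_eq_3I[OF rota_baxter_peirce_operator[OF u(1,3,4)]])
qed

end

theorem mainTheorem20:
  fixes scale :: "'a::field_char_0 \<Rightarrow> 'v::ab_group_add \<Rightarrow> 'v"
    and mult :: "'v \<Rightarrow> 'v \<Rightarrow> 'v"
    and q :: "'v \<Rightarrow> 'a"
  assumes "composition_algebra scale mult q"
    and "unital mult"
  shows "((division_ca q \<or> vector_space.dim scale (UNIV :: 'v set) \<le> 2)
           \<longrightarrow> rb_index scale mult = 1)
       \<and> ((split_ca q \<and> vector_space.dim scale (UNIV :: 'v set) \<in> {4, 8})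
           \<longrightarrow> rb_index scale mult = 3)"
proof -
  obtain e where e: "e \<noteq> 0" "\<And>x. mult e x = x" "\<And>x. mult x e = x"
    using assms(2) unfolding unital_def by blast
  interpret vector_space scale
    using assms(1) by (simp add: composition_algebra_def)
  interpret unital_composition_algebra scale q mult e
    using assms(1) e by unfold_locales (simp_all add: composition_algebra_def)
  show ?thesis
    using rb_index_division rb_index_dim_le_2 rb_index_split by auto
qed

end
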